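(* Let $n\in\mathbb{N}$ and equip $\mathbb{R}^n$ with the Euclidean metric. A typical compact set $K\in\mathcal{K}(\mathbb{R}^n)$ has the following property: for every $r\in(0,1)$ there exists a GIFS$_\infty$ $\mathcal{F}$ on $\mathbb{R}^n$ such that $K$ is the fractal of $\mathcal{F}$ and $\operatorname{Lip}(f)\le r$ for every $f\in\mathcal{F}$. That is, the set of all $K\in\mathcal{K}(\mathbb{R}^n)$ with this property is co-meager in $\mathcal{K}(\mathbb{R}^n)$.
   Context: For a metric space $(X,d)$, $\mathcal{K}(X)$ is the space of nonempty compact subsets of $X$ with the Hausdorff metric $H$ (complete if $X$ is complete). A typical element of a complete metric space has a property if the set of elements having that property is co-meager (its complement is meager, i.e. a countable union of nowhere dense sets). $\ell_\infty(X)$ is the set of all bounded sequences $(x_k)_{k\in\mathbb{N}}$ of elements of $X$, with the supremum metric $d_1((x_k),(y_k))=\sup_{k} d(x_k,y_k)$; $\ell_\infty(\mathcal{K}(X))$ is defined likewise from $(\mathcal{K}(X),H)$. $\operatorname{Lip}(f)$ denotes the (least) Lipschitz constant of $f$, and $f$ is a contraction if $\operatorname{Lip}(f)<1$. A map $f:\ell_\infty(X)\to X$ satisfies condition (C1) if for every $(K_k)\in\ell_\infty(\mathcal{K}(X))$ the closure $\overline{f(\prod_{k=1}^\infty K_k)}$ belongs to $\mathcal{K}(X)$. A generalized iterated function system of infinite order (GIFS$_\infty$) on $X$ is a finite family $\mathcal{F}=\{f_1,\dots,f_p\}$ of contractions $f_i:\ell_\infty(X)\to X$ each satisfying (C1).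 If $X$ is complete, it is known (Secelean) that there is a unique $A\in\mathcal{K}(X)$ with $A=\bigcup_{i=1}^p\overline{f_i(A\times A\times\cdots)}$; this set $A$ is called the fractal (or attractor) of $\mathcal{F}$. *)

theory Defs
  imports "HOL-Analysis.Analysis"
begin

section \<open>Typical elements of a space\<close>

definition nowhere_dense_in :: "'a topology \<Rightarrow> 'a set \<Rightarrow> bool" where
  "nowhere_dense_in X S \<longleftrightarrow> S \<subseteq> topspace X \<and> X interior_of (X closure_of S) = {}"

definition meager_in :: "'a topology \<Rightarrow> 'a set \<Rightarrow> bool" where
  "meager_in X S \<longleftrightarrow> (\<exists>N :: nat \<Rightarrow> 'a set. (\<forall>i. nowhere_dense_in X (N i)) \<and> S = (\<Union>i. N i))"

definition comeager_in :: "'a topology \<Rightarrow> 'a set \<Rightarrow> bool" where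
  "comeager_in X S \<longleftrightarrow> S \<subseteq> topspace X \<and> meager_in X (topspace X - S)"

definition typical_in :: "'a metric \<Rightarrow> ('a \<Rightarrow> bool) \<Rightarrow> bool" where
  "typical_in m P \<longleftrightarrow> comeager_in (mtopology_of m) {x \<in> mspace m. P x}"


section \<open>The hyperspace of nonempty compact subsets\<close>

definition nonempty_compacts :: "'a metric \<Rightarrow> 'a set set" where
  "nonempty_compacts m = {K. compactin (mtopology_of m) K \<and> K \<noteq> {}}"

text \<open>The default value \<open>0\<close> off the carrier is there because the locale \<open>Metric_space\<close> asks for
  nonnegativity and symmetry at all arguments, not only on the carrier.\<close>

definition hausdorff_dist :: "'a metric \<Rightarrow> 'a set \<Rightarrow> 'a set \<Rightarrow> real" where
  "hausdorff_dist m A B =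
     (if A \<in> nonempty_compacts m \<and> B \<in> nonempty_compacts m
      then max (SUP a\<in>A. INF b\<in>B. mdist m a b) (SUP b\<in>B. INF a\<in>A. mdist m a b)
      else 0)"

definition hyperspace :: "'a metric \<Rightarrow> 'a set metric" where
  "hyperspace m = metric (nonempty_compacts m, hausdorff_dist m)"

lemma nonempty_compactsD:
  assumes "A \<in> nonempty_compacts m"
  shows "A \<noteq> {}" "A \<subseteq> mspace m" "compactin (mtopology_of m) A"
  using assms compactin_subset_topspace[of "mtopology_of m" A]
  by (auto simp: nonempty_compacts_def)

lemma bdd_above_setdist:
  assumes "A \<in> nonempty_compacts m" "B \<in> nonempty_compacts m"
  shows "bdd_above ((\<lambda>a. INF b\<in>B. mdist m a b) ` A)"
proof -
  interpret Metric_space "mspace m" "mdist m" by simp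
  have "mbounded A"
    using compactin_imp_mbounded nonempty_compactsD(3)[OF assms(1)] by (simp add: mtopology_of_def)
  moreover obtain b where b: "b \<in> B" "b \<in> mspace m"
    using nonempty_compactsD[OF assms(2)] by blast
  ultimately have "mbounded (insert b A)" by (simp add: mbounded_insert)
  then obtain C where C: "\<And>a. a \<in> A \<Longrightarrow> mdist m a b \<le> C"
    unfolding mbounded_alt by blast
  have "(INF b\<in>B. mdist m a b) \<le> C" if "a \<in> A" for a
  proof -
    have "(INF b\<in>B. mdist m a b) \<le> mdist m a b"
      by (rule cINF_lower) (use b in \<open>auto intro!: bdd_belowI2[of _ 0]\<close>)
    then show ?thesis using C[OF that] by simp
  qed
  then show ?thesis by (rule bdd_aboveI2)
qed

lemma setdist_SUP_le_iff:
  assumes "A \<in> nonempty_compacts m" "B \<in> nonempty_compacts m"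
  shows "(SUP a\<in>A. INF b\<in>B. mdist m a b) \<le> r \<longleftrightarrow> (\<forall>a\<in>A. \<forall>e>0. \<exists>b\<in>B. mdist m a b < r + e)"
proof -
  have *: "(INF b\<in>B. mdist m a b) \<le> r \<longleftrightarrow> (\<forall>e>0. \<exists>b\<in>B. mdist m a b < r + e)" for a
  proof -
    have "(INF b\<in>B. mdist m a b) < s \<longleftrightarrow> (\<exists>b\<in>B. mdist m a b < s)" for s
      by (rule cINF_less_iff)
         (use nonempty_compactsD(1)[OF assms(2)] in \<open>auto intro!: bdd_belowI2[of _ 0]\<close>)
    moreover have "(x::real) \<le> r \<longleftrightarrow> (\<forall>e>0. x < r + e)" for x
    proof
      assume *: "\<forall>e>0. x < r + e"
      show "x \<le> r" by (rule field_le_epsilon) (use * in \<open>auto intro: less_imp_le\<close>)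
    qed auto
    ultimately show ?thesis by simp
  qed
  show ?thesis
    using cSUP_le_iff[OF nonempty_compactsD(1)[OF assms(1)] bdd_above_setdist[OF assms], of r] *
    by simp
qed

lemma hausdorff_dist_le_iff:
  assumes "A \<in> nonempty_compacts m" "B \<in> nonempty_compacts m"
  shows "hausdorff_dist m A B \<le> r \<longleftrightarrow>
    (\<forall>a\<in>A. \<forall>e>0. \<exists>b\<in>B. mdist m a b < r + e) \<and> (\<forall>b\<in>B. \<forall>e>0. \<exists>a\<in>A. mdist m a b < r + e)"
  using setdist_SUP_le_iff[OF assms] setdist_SUP_le_iff[OF assms(2,1)] assms
  by (simp add: hausdorff_dist_def mdist_commute)

lemma hausdorff_dist_approx:
  assumes "A \<in> nonempty_compacts m" "B \<in> nonempty_compacts m" "a \<in> A"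
    "hausdorff_dist m A B < r"
  shows "\<exists>b\<in>B. mdist m a b < r"
proof -
  have "\<forall>e>0. \<exists>b\<in>B. mdist m a b < hausdorff_dist m A B + e"
    using hausdorff_dist_le_iff[OF assms(1,2), of "hausdorff_dist m A B"] assms(3) by blast
  from this[rule_format, of "r - hausdorff_dist m A B"] show ?thesis using assms(4) by simp
qed

lemma hausdorff_dist_commute: "hausdorff_dist m A B = hausdorff_dist m B A"
  by (simp add: hausdorff_dist_def max.commute mdist_commute)

lemma hausdorff_dist_nonneg: "0 \<le> hausdorff_dist m A B"
proof (cases "A \<in> nonempty_compacts m \<and> B \<in> nonempty_compacts m")
  case True
  then obtain a where a: "a \<in> A" using nonempty_compactsD(1) by blast
  show ?thesis
  proof (rule ccontr)
    assume "\<not> 0 \<le> hausdorff_dist m A B"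
    then have "hausdorff_dist m A B < 0" by simp
    from hausdorff_dist_approx[OF _ _ a this] True obtain b where "mdist m a b < 0" by blast
    then show False using mdist_nonneg[of m a b] by simp
  qed
qed (auto simp: hausdorff_dist_def)

lemma hausdorff_dist_zero_subset:
  assumes "A \<in> nonempty_compacts m" "B \<in> nonempty_compacts m" "hausdorff_dist m A B = 0"
  shows "A \<subseteq> B"
proof
  fix a assume a: "a \<in> A"
  interpret Metric_space "mspace m" "mdist m" by simp
  have am: "a \<in> mspace m" using a nonempty_compactsD(2)[OF assms(1)] by blast
  have "closedin mtopology B"
    using compactin_imp_closedin Hausdorff_space_mtopology nonempty_compactsD(3)[OF assms(2)]
    by (auto simp: mtopology_of_def)
  moreover have "a \<in> mtopology closure_of B"
    unfolding metric_closure_of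
    using am hausdorff_dist_approx[OF assms(1,2) a] assms(3) nonempty_compactsD(2)[OF assms(2)]
    by fastforce
  ultimately show "a \<in> B" by (simp add: closure_of_closedin)
qed

lemma Metric_space_hyperspace: "Metric_space (nonempty_compacts m) (hausdorff_dist m)"
proof
  fix A B
  assume AB: "A \<in> nonempty_compacts m" "B \<in> nonempty_compacts m"
  show "hausdorff_dist m A B = 0 \<longleftrightarrow> A = B"
  proof
    assume "hausdorff_dist m A B = 0"
    then show "A = B"
      using hausdorff_dist_zero_subset[OF AB] hausdorff_dist_zero_subset[OF AB(2,1)]
      by (simp add: hausdorff_dist_commute)
  next
    assume "A = B"
    moreover have "hausdorff_dist m A A \<le> 0"
      unfolding hausdorff_dist_le_iff[OF AB(1) AB(1)]
      using nonempty_compactsD(2)[OF AB(1)]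
      by (metis add_0 mdist_zero subsetD)
    ultimately show "hausdorff_dist m A B = 0" using hausdorff_dist_nonneg[of m A A] by simp
  qed
next
  fix A B C
  assume K: "A \<in> nonempty_compacts m" "B \<in> nonempty_compacts m" "C \<in> nonempty_compacts m"
  have one_side: "\<exists>c\<in>C. mdist m a c < hausdorff_dist m A B + hausdorff_dist m B C + e"
    if K: "A \<in> nonempty_compacts m" "B \<in> nonempty_compacts m" "C \<in> nonempty_compacts m"
      and a: "a \<in> A" and e: "e > 0" for A B C a and e :: real
  proof -
    obtain b where b: "b \<in> B" "mdist m a b < hausdorff_dist m A B + e/2"
      using hausdorff_dist_approx[OF K(1,2) a, of "hausdorff_dist m A B + e/2"] e by auto
    obtain c where c: "c \<in> C" "mdist m b c < hausdorff_dist m B C + e/2"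
      using hausdorff_dist_approx[OF K(2,3) b(1), of "hausdorff_dist m B C + e/2"] e by auto
    have "mdist m a c \<le> mdist m a b + mdist m b c"
      using a b(1) c(1) K nonempty_compactsD(2) by (metis mdist_triangle subsetD)
    then show ?thesis using b c by (intro bexI[of _ c]) auto
  qed
  show "hausdorff_dist m A C \<le> hausdorff_dist m A B + hausdorff_dist m B C"
    unfolding hausdorff_dist_le_iff[OF K(1,3)]
  proof (intro conjI ballI allI impI)
    fix c and e :: real
    assume "c \<in> C" "e > 0"
    from one_side[OF K(3,2,1) this]
    show "\<exists>a\<in>A. mdist m a c < hausdorff_dist m A B + hausdorff_dist m B C + e"
      by (metis add.commute hausdorff_dist_commute mdist_commute)
  qed (rule one_side[OF K])
qed (auto simp: hausdorff_dist_nonneg hausdorff_dist_commute)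

lemma mspace_hyperspace [simp]: "mspace (hyperspace m) = nonempty_compacts m"
  by (simp add: hyperspace_def Metric_space.mspace_metric[OF Metric_space_hyperspace])

lemma mdist_hyperspace [simp]: "mdist (hyperspace m) = hausdorff_dist m"
  by (simp add: hyperspace_def Metric_space.mdist_metric[OF Metric_space_hyperspace])


section \<open>Iterated function systems of infinite order\<close>

definition ell_infty :: "'a metric \<Rightarrow> (nat \<Rightarrow> 'a) metric" where
  "ell_infty m = funspace UNIV m"

text \<open>This is the least Lipschitz constant only if \<open>f\<close> is Lipschitz, since \<open>Inf {}\<close> is
  unspecified on the reals. It is always used together with \<open>Lipschitz_continuous_map\<close>.\<close>

definition Lip :: "'a metric \<Rightarrow> 'b metric \<Rightarrow> ('a \<Rightarrow> 'b) \<Rightarrow> real" where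
  "Lip m m' f =
     Inf {L. 0 \<le> L \<and> (\<forall>x\<in>mspace m. \<forall>y\<in>mspace m. mdist m' (f x) (f y) \<le> L * mdist m x y)}"

definition contraction_map :: "'a metric \<Rightarrow> 'b metric \<Rightarrow> ('a \<Rightarrow> 'b) \<Rightarrow> bool" where
  "contraction_map m m' f \<longleftrightarrow> Lipschitz_continuous_map m m' f \<and> Lip m m' f < 1"

text \<open>For a bounded sequence \<open>K\<close> of compact sets, all elements of the product are bounded
  sequences, so \<open>f\<close> is only evaluated on the space \<open>ell_infty m\<close>.\<close>

definition C1 :: "'a metric \<Rightarrow> ((nat \<Rightarrow> 'a) \<Rightarrow> 'a) \<Rightarrow> bool" where
  "C1 m f \<longleftrightarrow> (\<forall>K \<in> mspace (ell_infty (hyperspace m)).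
     mtopology_of m closure_of (f ` (\<Pi>\<^sub>E k\<in>UNIV. K k)) \<in> nonempty_compacts m)"

definition GIFS_infty :: "'a metric \<Rightarrow> ((nat \<Rightarrow> 'a) \<Rightarrow> 'a) set \<Rightarrow> bool" where
  "GIFS_infty m F \<longleftrightarrow> finite F \<and> F \<noteq> {} \<and> (\<forall>f\<in>F. contraction_map (ell_infty m) m f \<and> C1 m f)"

definition is_fractal :: "'a metric \<Rightarrow> ((nat \<Rightarrow> 'a) \<Rightarrow> 'a) set \<Rightarrow> 'a set \<Rightarrow> bool" where
  "is_fractal m F A \<longleftrightarrow> A \<in> nonempty_compacts m \<and>
     A = (\<Union>f\<in>F. mtopology_of m closure_of (f ` (\<Pi>\<^sub>E k\<in>UNIV. A)))"

lemma Lip_least: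
  assumes "Lipschitz_continuous_map m m' f"
  shows "0 \<le> Lip m m' f"
    and "\<And>x y. x \<in> mspace m \<Longrightarrow> y \<in> mspace m \<Longrightarrow> mdist m' (f x) (f y) \<le> Lip m m' f * mdist m x y"
    and "\<And>L. 0 \<le> L \<Longrightarrow>
           (\<And>x y. x \<in> mspace m \<Longrightarrow> y \<in> mspace m \<Longrightarrow> mdist m' (f x) (f y) \<le> L * mdist m x y) \<Longrightarrow>
           Lip m m' f \<le> L"
proof -
  let ?S = "{L. 0 \<le> L \<and> (\<forall>x\<in>mspace m. \<forall>y\<in>mspace m. mdist m' (f x) (f y) \<le> L * mdist m x y)}"
  obtain B where B: "0 < B" "\<forall>x\<in>mspace m. \<forall>y\<in>mspace m. mdist m' (f x) (f y) \<le> B * mdist m x y"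
    using assms unfolding Lipschitz_continuous_map_pos by blast
  have "B \<in> ?S" using B by (simp only: mem_Collect_eq) simp
  then have ne: "?S \<noteq> {}" by blast
  have bdd: "bdd_below ?S" by (rule bdd_belowI[of _ 0]) simp
  show "0 \<le> Lip m m' f" unfolding Lip_def by (rule cInf_greatest[OF ne]) blast
  show "Lip m m' f \<le> L" if "0 \<le> L"
    "\<And>x y. x \<in> mspace m \<Longrightarrow> y \<in> mspace m \<Longrightarrow> mdist m' (f x) (f y) \<le> L * mdist m x y" for L
    unfolding Lip_def by (rule cInf_lower[OF _ bdd]) (use that in blast)
  show "mdist m' (f x) (f y) \<le> Lip m m' f * mdist m x y" if "x \<in> mspace m" "y \<in> mspace m" for x y
  proof (cases "mdist m x y = 0")
    case True
    moreover have "mdist m' (f x) (f y) \<le> B * mdist m x y" using B that by blast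
    ultimately show ?thesis by simp
  next
    case False
    then have pos: "mdist m x y > 0" using mdist_nonneg[of m x y] by linarith
    have "mdist m' (f x) (f y) / mdist m x y \<le> Lip m m' f"
      unfolding Lip_def
    proof (rule cInf_greatest[OF ne])
      fix L assume "L \<in> ?S"
      then have "mdist m' (f x) (f y) \<le> L * mdist m x y" using that by blast
      then show "mdist m' (f x) (f y) / mdist m x y \<le> L" using pos by (simp add: pos_divide_le_eq)
    qed
    then show ?thesis using pos by (simp add: pos_divide_le_eq)
  qed
qed

lemma seq_in_ell_infty:
  assumes "A \<in> nonempty_compacts m" "x \<in> (\<Pi>\<^sub>E k\<in>UNIV. A)"
  shows "x \<in> mspace (ell_infty m)"
proof -
  interpret Metric_space "mspace m" "mdist m" by simp
  have "mbounded A"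
    using compactin_imp_mbounded nonempty_compactsD(3)[OF assms(1)] by (simp add: mtopology_of_def)
  moreover have "range x \<subseteq> A" using assms(2) by auto
  ultimately show ?thesis
    using mbounded_subset nonempty_compactsD(2)[OF assms(1)]
    by (auto simp: ell_infty_def fspace_def)
qed

text \<open>Hence \<open>is_fractal m F A\<close> says that \<open>A\<close> is \<^emph>\<open>the\<close> fractal of \<open>F\<close>.\<close>

lemma is_fractal_unique:
  assumes F: "GIFS_infty m F" and A: "is_fractal m F A" and B: "is_fractal m F B"
  shows "A = B"
proof -
  interpret Metric_space "mspace m" "mdist m" by simp
  define h where "h = hausdorff_dist m A B"
  define L where "L = Max ((\<lambda>f. Lip (ell_infty m) m f) ` F)"
  have fin: "finite F" "F \<noteq> {}"
    and con: "\<And>f. f \<in> F \<Longrightarrow> contraction_map (ell_infty m) m f"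
    using F by (auto simp: GIFS_infty_def)
  have L1: "L < 1" unfolding L_def using fin con by (subst Max_less_iff) (auto simp: contraction_map_def)
  have LL: "Lip (ell_infty m) m f \<le> L" if "f \<in> F" for f unfolding L_def using fin that by simp
  have L0: "0 \<le> L"
  proof -
    obtain f where f: "f \<in> F" using fin by blast
    then have "0 \<le> Lip (ell_infty m) m f" using con[OF f] by (simp add: contraction_map_def Lip_least(1))
    then show ?thesis using LL[OF f] by simp
  qed
  have h0: "0 \<le> h" by (simp add: h_def hausdorff_dist_nonneg)
  have step: "\<exists>b\<in>B. mdist m a b < L * h + e"
    if A: "is_fractal m F A" and B: "is_fractal m F B" and h: "hausdorff_dist m A B = h"
      and a: "a \<in> A" and e: "e > 0" for A B a and e :: real
  proof -
    have K: "A \<in> nonempty_compacts m" "B \<in> nonempty_compacts m"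
      using A B by (auto simp: is_fractal_def)
    obtain f where f: "f \<in> F" "a \<in> mtopology closure_of (f ` (\<Pi>\<^sub>E k\<in>UNIV. A))"
    proof -
      have "A \<subseteq> (\<Union>f\<in>F. mtopology closure_of (f ` (\<Pi>\<^sub>E k\<in>UNIV. A)))"
        using A unfolding is_fractal_def mtopology_of_def by (elim conjE equalityD1)
      then show ?thesis using a that by blast
    qed
    have am: "a \<in> mspace m" using a nonempty_compactsD(2)[OF K(1)] by (rule rev_subsetD)
    have "\<forall>r>0. \<exists>y \<in> f ` (\<Pi>\<^sub>E k\<in>UNIV. A). y \<in> mball a r"
      using f(2) unfolding metric_closure_of mem_Collect_eq by (rule conjunct2)
    then have "\<exists>y \<in> f ` (\<Pi>\<^sub>E k\<in>UNIV. A). y \<in> mball a (e/2)"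
      by (rule allE[where x = "e/2"]) (use e in simp)
    then obtain x where x: "x \<in> (\<Pi>\<^sub>E k\<in>UNIV. A)" and fx: "f x \<in> mspace m" "mdist m a (f x) < e/2"
      unfolding in_mball by blast
    have xA: "x k \<in> A" for k using x by (rule PiE_mem) simp
    have "hausdorff_dist m A B < h + e/2" using h e by simp
    then have "\<forall>k. \<exists>b\<in>B. mdist m (x k) b < h + e/2"
      by (intro allI hausdorff_dist_approx[OF K xA])
    then obtain y where y: "\<And>k. y k \<in> B" "\<And>k. mdist m (x k) (y k) < h + e/2" by metis
    have yB: "y \<in> (\<Pi>\<^sub>E k\<in>UNIV. B)" using y by auto
    have xy: "x \<in> mspace (ell_infty m)" "y \<in> mspace (ell_infty m)"
      using seq_in_ell_infty K x yB by blast+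
    have "mdist (ell_infty m) x y \<le> h + e/2"
    proof -
      have "(SUP k. mdist m (x k) (y k)) \<le> h + e/2"
        by (rule cSUP_least) (use y(2) in \<open>auto intro: less_imp_le\<close>)
      then show ?thesis using xy unfolding ell_infty_def by (simp add: fdist_def)
    qed
    then have "Lip (ell_infty m) m f * mdist (ell_infty m) x y \<le> L * (h + e/2)"
      using LL[OF f(1)] L0 by (intro mult_mono) auto
    moreover have "L * (e/2) \<le> e/2" using L1 e by simp
    moreover have "mdist m (f x) (f y) \<le> Lip (ell_infty m) m f * mdist (ell_infty m) x y"
      by (rule Lip_least(2)) (use con[OF f(1)] xy in \<open>simp_all add: contraction_map_def\<close>)
    ultimately have fxy: "mdist m (f x) (f y) \<le> L * h + e/2" by (simp add: distrib_left)
    have fm: "f z \<in> mspace m" if "z \<in> mspace (ell_infty m)" for z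
      by (rule funcset_mem[OF Lipschitz_continuous_map_image that])
         (use con[OF f(1)] in \<open>simp add: contraction_map_def\<close>)
    then have fy: "f y \<in> mspace m" using xy(2) .
    have "f ` (\<Pi>\<^sub>E k\<in>UNIV. B) \<subseteq> mspace m"
      by (intro image_subsetI fm seq_in_ell_infty[OF K(2)])
    then have "f y \<in> mtopology closure_of (f ` (\<Pi>\<^sub>E k\<in>UNIV. B))"
      using closure_of_subset[of "f ` (\<Pi>\<^sub>E k\<in>UNIV. B)" mtopology] yB by auto
    moreover have "(\<Union>f\<in>F. mtopology closure_of (f ` (\<Pi>\<^sub>E k\<in>UNIV. B))) \<subseteq> B"
      using B unfolding is_fractal_def mtopology_of_def by (elim conjE equalityD2)
    ultimately have "f y \<in> B" using f(1) by blast
    moreover have "mdist m a (f y) \<le> mdist m a (f x) + mdist m (f x) (f y)"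
      using am fx fy by (simp add: triangle)
    ultimately show ?thesis using fx fxy by (intro bexI[of _ "f y"]) auto
  qed
  have K: "A \<in> nonempty_compacts m" "B \<in> nonempty_compacts m"
    using A B by (auto simp: is_fractal_def)
  have "hausdorff_dist m A B \<le> L * h"
    unfolding hausdorff_dist_le_iff[OF K]
    unfolding h_def[symmetric]
  proof (intro conjI ballI allI impI)
    fix b and e :: real
    assume "b \<in> B" "e > 0"
    from step[OF B A _ this] show "\<exists>a\<in>A. mdist m a b < L * h + e"
      by (metis h_def hausdorff_dist_commute mdist_commute)
  qed (rule step[OF A B h_def[symmetric]])
  then have "(1 - L) * h \<le> 0" by (simp add: h_def[symmetric] left_diff_distrib)
  then have "h = 0" using L1 h0 by (simp add: mult_le_0_iff)
  then show ?thesis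
    using Metric_space.zero[OF Metric_space_hyperspace K] by (simp add: h_def)
qed

end

theory Submission
  imports Defs
begin

text \<open>Every disconnected compact set \<open>K\<close> has the property, and these sets are open and dense in the
  hyperspace: adding to \<open>K\<close> a point just outside of \<open>K\<close> disconnects it.

  Let \<open>K = A \<union> B\<close> with a gap \<open>d > 0\<close> between \<open>A\<close> and \<open>B\<close>. Points of \<open>K\<^sup>\<omega>\<close> with different itineraries
  \<open>{k. x k \<in> A}\<close> are at distance at least \<open>d\<close>, and there are continuum many itineraries. Hence any
  piece of \<open>K\<close> is the image of \<open>K\<^sup>\<omega>\<close> under a map that depends only on the itinerary, and this map is
  Lipschitz with a constant as small as we like if the piece is small. McShane's formula extends it
  to all bounded sequences, where (C1) is automatic because bounded sets are relatively compact.\<close>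

section \<open>Surjections from the power set of the naturals\<close>

text \<open>A point of a second countable T0 space is determined by the indices of the basic open
  sets that contain it. This injects the space into \<open>nat set\<close>, and a left inverse gives
  \<open>h\<close>. Itineraries are elements of \<open>nat set\<close>, so \<open>h\<close> is what
  turns an itinerary into a point of a given piece.\<close>

lemma ex_surj_nat_set:
  fixes X :: "'a::{second_countable_topology, t0_space} set"
  assumes "X \<noteq> {}"
  shows "\<exists>h :: nat set \<Rightarrow> 'a. range h = X"
proof -
  obtain B :: "'a set set" where B: "countable B" "topological_basis B"
    using ex_countable_basis by blast
  \<comment> \<open>\<open>from_nat_into\<close> enumerates exactly \<open>B\<close> only for
    nonempty \<open>B\<close>.\<close>
  have "B \<noteq> {}"
  proof
    assume "B = {}"
    then have "(UNIV :: 'a set) = {}"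
      using B(2) open_UNIV unfolding topological_basis_def by fastforce
    then show False by simp
  qed
  then have range: "range (from_nat_into B) = B" using B(1) by (rule range_from_nat_into)
  define c where "c = (\<lambda>x. {n. x \<in> from_nat_into B n})"
  have "inj c"
  proof (rule injI, rule ccontr)
    fix x y assume c: "c x = c y" and "x \<noteq> y"
    from iffD1[OF separation_t0 \<open>x \<noteq> y\<close>]
    obtain U where U: "open U" "\<not> (x \<in> U \<longleftrightarrow> y \<in> U)" by blast
    obtain B' where B': "B' \<subseteq> B" "\<Union>B' = U"
      using B(2) U(1) unfolding topological_basis_def by blast
    then obtain V where V: "V \<in> B" "(x \<in> V) \<noteq> (y \<in> V)" using U(2) by blast
    then obtain n where "from_nat_into B n = V" using range by (metis rangeE)
    then have "(n \<in> c x) \<noteq> (n \<in> c y)" using V(2) by (simp add: c_def)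
    then show False using c by simp
  qed
  obtain x0 where x0: "x0 \<in> X" using assms by blast
  \<comment> \<open>The default \<open>x0\<close> catches codes \<open>s\<close> that no point of
    \<open>X\<close> has.\<close>
  define h where "h = (\<lambda>s. if inv c s \<in> X then inv c s else x0)"
  have "range h = X"
  proof
    show "range h \<subseteq> X" using x0 by (auto simp: h_def)
    show "X \<subseteq> range h"
    proof
      fix x assume "x \<in> X"
      then have "h (c x) = x" using \<open>inj c\<close> by (simp add: h_def)
      then show "x \<in> range h" by (metis rangeI)
    qed
  qed
  then show ?thesis by blast
qed

section \<open>Extension of Lipschitz maps\<close>

text \<open>McShane's formula: take the infimum of the cones of slope \<open>L\<close> standing on
  the graph of \<open>g\<close>. Each cone is \<open>L\<close>-Lipschitz, so the infimum is too;
  over a point of \<open>S\<close> the lowest cone is the one with its apex there.\<close>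

lemma real_Lipschitz_extension:
  fixes g :: "'a \<Rightarrow> real"
  assumes S: "S \<subseteq> mspace m" "S \<noteq> {}" and L: "0 \<le> L"
    and g: "\<And>x y. x \<in> S \<Longrightarrow> y \<in> S \<Longrightarrow> \<bar>g x - g y\<bar> \<le> L * mdist m x y"
  shows "\<exists>f. (\<forall>x\<in>S. f x = g x) \<and> (\<forall>x\<in>mspace m. \<forall>y\<in>mspace m. \<bar>f x - f y\<bar> \<le> L * mdist m x y)"
proof -
  define f where "f = (\<lambda>x. INF s\<in>S. g s + L * mdist m x s)"
  have Ltri: "L * mdist m x z \<le> L * mdist m x y + L * mdist m y z"
    if "x \<in> mspace m" "y \<in> mspace m" "z \<in> mspace m" for x y z
    using mult_left_mono[OF mdist_triangle[OF that] L] by (simp add: distrib_left)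
  obtain s0 where s0: "s0 \<in> S" using S by blast
  have bdd: "bdd_below ((\<lambda>s. g s + L * mdist m x s) ` S)" if "x \<in> mspace m" for x
  proof (rule bdd_belowI2)
    fix s assume s: "s \<in> S"
    \<comment> \<open>A lower bound independent of \<open>s\<close>, so the infimum is a genuine
      one.\<close>
    show "g s0 - L * mdist m x s0 \<le> g s + L * mdist m x s"
      using g[OF s0 s] Ltri[of s0 x s] subsetD[OF S(1) s] subsetD[OF S(1) s0] that
      by (simp add: mdist_commute[of m s0 x])
  qed
  have "f x = g x" if x: "x \<in> S" for x
  proof (rule antisym)
    have xm: "x \<in> mspace m" using x S by blast
    show "f x \<le> g x"
      unfolding f_def using cINF_lower[OF bdd[OF xm] x] mdist_zero[OF xm xm] by simp
    show "g x \<le> f x"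
      unfolding f_def
    proof (rule cINF_greatest[OF S(2)])
      fix s assume "s \<in> S"
      then show "g x \<le> g s + L * mdist m x s" using g[OF x, of s] by auto
    qed
  qed
  moreover have one_side: "f x \<le> f y + L * mdist m x y" if xy: "x \<in> mspace m" "y \<in> mspace m" for x y
  proof -
    have "f x - L * mdist m x y \<le> f y"
      unfolding f_def[THEN fun_cong, of y]
    proof (rule cINF_greatest[OF S(2)])
      fix s assume s: "s \<in> S"
      have "f x \<le> g s + L * mdist m x s"
        unfolding f_def by (rule cINF_lower[OF bdd[OF xy(1)] s])
      then show "f x - L * mdist m x y \<le> g s + L * mdist m y s"
        using Ltri[OF xy subsetD[OF S(1) s]] by simp
    qed
    then show ?thesis by simp
  qed
  have "\<bar>f x - f y\<bar> \<le> L * mdist m x y" if "x \<in> mspace m" "y \<in> mspace m" for x y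
    using one_side[OF that] one_side[OF that(2,1)] by (simp add: mdist_commute)
  ultimately show ?thesis by blast
qed

text \<open>Each coordinate is extended by McShane's formula. Bounding the norm by the sum of the
  absolute coordinates costs the factor \<open>DIM('b)\<close>, which is harmless because
  \<open>L\<close> can be chosen small beforehand.\<close>

lemma euclidean_Lipschitz_extension:
  fixes g :: "'a \<Rightarrow> 'b::euclidean_space" and L :: real
  assumes S: "S \<subseteq> mspace m" "S \<noteq> {}" and L: "0 \<le> L"
    and g: "\<And>x y. x \<in> S \<Longrightarrow> y \<in> S \<Longrightarrow> dist (g x) (g y) \<le> L * mdist m x y"
  shows "\<exists>f. (\<forall>x\<in>S. f x = g x) \<and>
    (\<forall>x\<in>mspace m. \<forall>y\<in>mspace m. dist (f x) (f y) \<le> (DIM('b) * L) * mdist m x y)"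
proof -
  have "\<forall>b\<in>Basis. \<exists>f. (\<forall>x\<in>S. f x = g x \<bullet> b) \<and>
    (\<forall>x\<in>mspace m. \<forall>y\<in>mspace m. \<bar>f x - f y\<bar> \<le> L * mdist m x y)"
  proof
    fix b :: 'b assume b: "b \<in> Basis"
    show "\<exists>f. (\<forall>x\<in>S. f x = g x \<bullet> b) \<and>
      (\<forall>x\<in>mspace m. \<forall>y\<in>mspace m. \<bar>f x - f y\<bar> \<le> L * mdist m x y)"
    proof (rule real_Lipschitz_extension[OF S L])
      fix x y assume xy: "x \<in> S" "y \<in> S"
      have "\<bar>(g x - g y) \<bullet> b\<bar> \<le> dist (g x) (g y)"
        unfolding dist_norm by (rule Basis_le_norm[OF b])
      then show "\<bar>g x \<bullet> b - g y \<bullet> b\<bar> \<le> L * mdist m x y"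
        using g[OF xy] by (simp add: inner_diff_left)
    qed
  qed
  then obtain F where F: "\<And>b x. b \<in> Basis \<Longrightarrow> x \<in> S \<Longrightarrow> F b x = g x \<bullet> b"
    "\<And>b x y. b \<in> Basis \<Longrightarrow> x \<in> mspace m \<Longrightarrow> y \<in> mspace m \<Longrightarrow> \<bar>F b x - F b y\<bar> \<le> L * mdist m x y"
    unfolding bchoice_iff by blast
  define f where "f = (\<lambda>x. \<Sum>b\<in>Basis. F b x *\<^sub>R b)"
  have "f x = g x" if "x \<in> S" for x
    using F(1) that by (simp add: f_def euclidean_representation)
  moreover have "dist (f x) (f y) \<le> (DIM('b) * L) * mdist m x y"
    if "x \<in> mspace m" "y \<in> mspace m" for x y
  proof -
    have "dist (f x) (f y) \<le> (\<Sum>b\<in>Basis. \<bar>(f x - f y) \<bullet> b\<bar>)"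
      unfolding dist_norm by (rule norm_le_l1)
    also have "\<dots> = (\<Sum>b\<in>Basis. \<bar>F b x - F b y\<bar>)"
      by (rule sum.cong) (simp_all add: f_def inner_diff_left)
    also have "\<dots> \<le> (\<Sum>b\<in>(Basis::'b set). L * mdist m x y)"
      by (rule sum_mono) (use F(2) that in blast)
    finally show ?thesis by simp
  qed
  ultimately show ?thesis by blast
qed

section \<open>Bounded sequences and condition (C1)\<close>

lemma mspace_ell_infty_euclidean:
  "x \<in> mspace (ell_infty (euclidean_metric :: 'a::metric_space metric)) \<longleftrightarrow> bounded (range x)"
  by (simp add: ell_infty_def Met_TC.fspace_def)

lemma dist_le_mdist_ell_infty:
  fixes x y :: "nat \<Rightarrow> 'a::metric_space"
  assumes "x \<in> mspace (ell_infty euclidean_metric)" "y \<in> mspace (ell_infty euclidean_metric)"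
  shows "dist (x k) (y k) \<le> mdist (ell_infty euclidean_metric) x y"
  using assms cSUP_upper[OF _ Met_TC.bdd_above_dist[of x UNIV y], of k]
  by (simp add: ell_infty_def Met_TC.fdist_def)

lemma mdist_ell_infty_le:
  fixes x y :: "nat \<Rightarrow> 'a::metric_space"
  assumes "x \<in> mspace (ell_infty euclidean_metric)" "y \<in> mspace (ell_infty euclidean_metric)"
    and "\<And>k. dist (x k) (y k) \<le> C"
  shows "mdist (ell_infty euclidean_metric) x y \<le> C"
  using assms cSUP_least[of UNIV "\<lambda>k. dist (x k) (y k)" C]
  by (simp add: ell_infty_def Met_TC.fdist_def)

lemma nonempty_compacts_euclidean:
  "K \<in> nonempty_compacts euclidean_metric \<longleftrightarrow> compact K \<and> K \<noteq> {}"
  by (simp add: nonempty_compacts_def)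

text \<open>Boundedness in the Hausdorff metric puts every \<open>K k\<close> within a fixed
  distance of the bounded set \<open>K 0\<close>.\<close>

lemma bounded_UN_ell_infty_hyperspace:
  fixes K :: "nat \<Rightarrow> 'a::metric_space set"
  assumes "K \<in> mspace (ell_infty (hyperspace euclidean_metric))"
  shows "\<And>k. K k \<in> nonempty_compacts euclidean_metric" "bounded (\<Union>k. K k)"
proof -
  interpret H: Metric_space "nonempty_compacts (euclidean_metric :: 'a metric)"
    "hausdorff_dist euclidean_metric"
    by (rule Metric_space_hyperspace)
  show K: "K k \<in> nonempty_compacts euclidean_metric" for k
    using assms by (auto simp: ell_infty_def H.fspace_def)
  have "H.mbounded (range K)"
    using assms by (simp add: ell_infty_def H.fspace_def)
  then obtain B where B: "\<And>k. hausdorff_dist euclidean_metric (K k) (K 0) \<le> B"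
    unfolding H.mbounded_alt by blast
  have "bounded (K 0)" using K[of 0] by (simp add: nonempty_compacts_euclidean compact_imp_bounded)
  then obtain a R where R: "\<And>x. x \<in> K 0 \<Longrightarrow> dist a x \<le> R" by (auto simp: bounded_def)
  have "dist a x \<le> R + (B + 1)" if x: "x \<in> K k" for x k
  proof -
    \<comment> \<open>The extra 1 makes the inequality strict, as
      \<open>hausdorff_dist_approx\<close> demands.\<close>
    have "hausdorff_dist euclidean_metric (K k) (K 0) < B + 1" using B[of k] by simp
    then obtain y where "y \<in> K 0" "dist x y < B + 1"
      using hausdorff_dist_approx[OF K K x] by auto
    then show ?thesis using R[of y] dist_triangle[of a x y] by (simp add: dist_commute)
  qed
  then show "bounded (\<Union>k. K k)" by (auto simp: bounded_def)
qed

text \<open>The product has finite diameter in the supremum metric, so its Lipschitz image is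
  bounded, and closures of bounded sets are compact by Heine-Borel.\<close>

lemma C1_euclidean:
  fixes f :: "(nat \<Rightarrow> 'a::heine_borel) \<Rightarrow> 'a"
  assumes f: "Lipschitz_continuous_map (ell_infty euclidean_metric) euclidean_metric f"
  shows "C1 euclidean_metric f"
  unfolding C1_def
proof
  fix K :: "nat \<Rightarrow> 'a set"
  assume "K \<in> mspace (ell_infty (hyperspace euclidean_metric))"
  note K = bounded_UN_ell_infty_hyperspace[OF this]
  let ?P = "\<Pi>\<^sub>E k\<in>UNIV. K k"
  obtain B where B: "0 < B" "\<And>x y. x \<in> mspace (ell_infty euclidean_metric) \<Longrightarrow>
      y \<in> mspace (ell_infty euclidean_metric) \<Longrightarrow> dist (f x) (f y) \<le> B * mdist (ell_infty euclidean_metric) x y"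
    using f unfolding Lipschitz_continuous_map_pos by auto
  \<comment> \<open>One \<open>R\<close> serves all coordinates, hence it also bounds the supremum
    distance on the product.\<close>
  obtain R where R: "\<And>x y. x \<in> (\<Union>k. K k) \<Longrightarrow> y \<in> (\<Union>k. K k) \<Longrightarrow> dist x y \<le> R"
    using K(2) unfolding bounded_two_points by blast
  have mem: "x \<in> mspace (ell_infty euclidean_metric)" if "x \<in> ?P" for x
    unfolding mspace_ell_infty_euclidean by (rule bounded_subset[OF K(2)]) (use that in auto)
  have "?P \<noteq> {}" using K(1) by (auto simp: PiE_eq_empty_iff nonempty_compacts_def)
  moreover have "bounded (f ` ?P)"
    unfolding bounded_two_points
  proof (intro exI ballI)
    fix u v assume "u \<in> f ` ?P" "v \<in> f ` ?P"
    then obtain x y where xy: "x \<in> ?P" "y \<in> ?P" "u = f x" "v = f y" by blast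
    have "mdist (ell_infty euclidean_metric) x y \<le> R"
    proof (rule mdist_ell_infty_le[OF mem[OF xy(1)] mem[OF xy(2)]])
      show "dist (x k) (y k) \<le> R" for k using xy by (intro R) auto
    qed
    then have "B * mdist (ell_infty euclidean_metric) x y \<le> B * R" using B(1) by simp
    then show "dist u v \<le> B * R" using B(2)[OF mem[OF xy(1)] mem[OF xy(2)]] xy by simp
  qed
  ultimately show "mtopology_of euclidean_metric closure_of (f ` ?P) \<in> nonempty_compacts euclidean_metric"
    by (simp add: nonempty_compacts_euclidean compact_closure)
qed

section \<open>Disconnected compact sets are fractals\<close>

text \<open>Both parts of a separation of \<open>K\<close> by closed sets are compact, and disjoint
  compact sets have positive distance.\<close>

lemma compact_disconnectedE:
  fixes K :: "'a::heine_borel set"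
  assumes "compact K" "\<not> connected K"
  obtains A B d where "K = A \<union> B" "A \<noteq> {}" "B \<noteq> {}" "0 < d"
    "\<And>x y. x \<in> A \<Longrightarrow> y \<in> B \<Longrightarrow> d \<le> dist x y"
proof -
  obtain A B where AB: "closed A" "closed B" "K \<subseteq> A \<union> B" "A \<inter> B \<inter> K = {}" "A \<inter> K \<noteq> {}" "B \<inter> K \<noteq> {}"
    using assms(2) unfolding connected_closed by blast
  have "compact (A \<inter> K)" "closed (B \<inter> K)"
    using AB(1,2) assms(1) by (auto intro: closed_Int_compact compact_imp_closed)
  then have "\<exists>d>0. \<forall>x\<in>A \<inter> K. \<forall>y\<in>B \<inter> K. d \<le> dist x y"
    by (rule separate_compact_closed) (use AB(4) in blast)
  then show ?thesis using that[of "A \<inter> K" "B \<inter> K"] AB by blast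
qed

text \<open>The pieces are \<open>K \<inter> cball c e\<close> with \<open>c\<close> in a finite set
  \<open>T\<close> whose \<open>e\<close>-balls cover \<open>K\<close>; the system has one map for
  each centre.\<close>

lemma disconnected_compact_is_fractal:
  fixes K :: "'a::euclidean_space set"
  assumes K: "compact K" "\<not> connected K" and r: "0 < r" "r < 1"
  shows "\<exists>F. GIFS_infty euclidean_metric F \<and> is_fractal euclidean_metric F K \<and>
    (\<forall>f\<in>F. Lip (ell_infty euclidean_metric) euclidean_metric f \<le> r)"
proof -
  let ?l = "ell_infty (euclidean_metric :: 'a metric)"
  let ?P = "\<Pi>\<^sub>E k\<in>(UNIV :: nat set). K"
  obtain A B d where AB: "K = A \<union> B" "A \<noteq> {}" "B \<noteq> {}" and d: "0 < d"
    "\<And>x y. x \<in> A \<Longrightarrow> y \<in> B \<Longrightarrow> d \<le> dist x y"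
    using compact_disconnectedE[OF K] by metis
  have disj: "A \<inter> B = {}" using d by force
  have P: "x \<in> ?P \<longleftrightarrow> range x \<subseteq> K" for x :: "nat \<Rightarrow> 'a" by auto
  have Psub: "?P \<subseteq> mspace ?l"
    using compact_imp_bounded[OF K(1)] bounded_subset
    unfolding mspace_ell_infty_euclidean subset_iff[of ?P] P by blast
  have Pne: "?P \<noteq> {}" using AB by (auto simp: PiE_eq_empty_iff)
  \<comment> \<open>Division by \<open>DIM('a)\<close> cancels the factor lost in the
    extension.\<close>
  define L where "L = r / DIM('a)"
  have L: "0 < L" "DIM('a) * L = r" using r by (simp_all add: L_def)
  \<comment> \<open>A piece then has diameter at most \<open>2 * e = L * d\<close>, while sequences
    with different itineraries are at least \<open>d\<close> apart. This is exactly the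
    \<open>L\<close>-Lipschitz condition for \<open>g\<close>.\<close>
  define e where "e = L * d / 2"
  have e: "0 < e" using L d by (simp add: e_def)
  have map: "\<exists>f. f ` ?P = K \<inter> cball c e \<and>
      (\<forall>x\<in>mspace ?l. \<forall>y\<in>mspace ?l. dist (f x) (f y) \<le> r * mdist ?l x y)" if c: "c \<in> K" for c
  proof -
    have "K \<inter> cball c e \<noteq> {}" using c e by auto
    then obtain h :: "nat set \<Rightarrow> 'a" where h: "range h = K \<inter> cball c e"
      using ex_surj_nat_set by metis
    define g where "g = (\<lambda>x. h {k. x k \<in> A})"
    have "\<exists>f. (\<forall>x\<in>?P. f x = g x) \<and>
        (\<forall>x\<in>mspace ?l. \<forall>y\<in>mspace ?l. dist (f x) (f y) \<le> (DIM('a) * L) * mdist ?l x y)"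
    proof (rule euclidean_Lipschitz_extension[OF Psub Pne])
      fix x y assume xy: "x \<in> ?P" "y \<in> ?P"
      then have xyl: "x \<in> mspace ?l" "y \<in> mspace ?l" using Psub by blast+
      show "dist (g x) (g y) \<le> L * mdist ?l x y"
      proof (cases "{k. x k \<in> A} = {k. y k \<in> A}")
        case True
        then show ?thesis using L by (simp add: g_def)
      next
        case False
        \<comment> \<open>At this index one sequence is in \<open>A\<close> and the other in
          \<open>B\<close>, so the gap \<open>d\<close> separates them.\<close>
        then obtain k where "x k \<in> A \<longleftrightarrow> y k \<notin> A" by blast
        moreover have "x k \<in> K" "y k \<in> K" using xy by auto
        ultimately have "d \<le> dist (x k) (y k)" using d(2) AB(1) by (metis UnE dist_commute)
        also have "\<dots> \<le> mdist ?l x y" using xyl by (rule dist_le_mdist_ell_infty)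
        finally have "L * d \<le> L * mdist ?l x y" using L by simp
        moreover have "g x \<in> cball c e" "g y \<in> cball c e" using h by (auto simp: g_def)
        then have "dist (g x) (g y) \<le> L * d"
          using dist_triangle[of "g x" "g y" c] by (simp add: e_def dist_commute)
        ultimately show ?thesis by simp
      qed
    qed (use L in simp)
    then obtain f where f: "\<And>x. x \<in> ?P \<Longrightarrow> f x = g x"
      "\<forall>x\<in>mspace ?l. \<forall>y\<in>mspace ?l. dist (f x) (f y) \<le> r * mdist ?l x y"
      unfolding L(2) by blast
    have "g ` ?P = range h"
    proof
      show "range h \<subseteq> g ` ?P"
      proof clarify
        fix s :: "nat set"
        obtain a b where ab: "a \<in> A" "b \<in> B" using AB by blast
        \<comment> \<open>A sequence with prescribed itinerary \<open>s\<close>: all itineraries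
          occur, so \<open>g\<close> attains every value of \<open>h\<close>.\<close>
        define x where "x = (\<lambda>k. if k \<in> s then a else b)"
        have "x \<in> ?P" using ab AB(1) by (auto simp: x_def)
        moreover have "{k. x k \<in> A} = s" using ab disj by (auto simp: x_def)
        ultimately show "h s \<in> g ` ?P" by (metis g_def imageI)
      qed
    qed (auto simp: g_def)
    then have "f ` ?P = K \<inter> cball c e" using f(1) h by (metis (no_types, lifting) image_cong)
    then show ?thesis using f(2) by blast
  qed
  \<comment> \<open>Open balls serve the compactness argument; the pieces use closed balls so that
    they are closed.\<close>
  obtain T where T: "finite T" "T \<subseteq> K" "K \<subseteq> (\<Union>c\<in>T. ball c e)"
  proof (rule compactE_image[OF K(1), of K "\<lambda>c. ball c e"])
    show "K \<subseteq> (\<Union>c\<in>K. ball c e)" using e by force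
  qed auto
  have "T \<noteq> {}" using T AB by auto
  have "\<forall>c\<in>K. \<exists>f. f ` ?P = K \<inter> cball c e \<and>
      (\<forall>x\<in>mspace ?l. \<forall>y\<in>mspace ?l. dist (f x) (f y) \<le> r * mdist ?l x y)"
    using map by blast
  then obtain f where fK: "\<forall>c\<in>K. f c ` ?P = K \<inter> cball c e \<and>
      (\<forall>x\<in>mspace ?l. \<forall>y\<in>mspace ?l. dist (f c x) (f c y) \<le> r * mdist ?l x y)"
    by (rule exE[OF bchoice])
  have f: "f c ` ?P = K \<inter> cball c e"
    "\<And>x y. x \<in> mspace ?l \<Longrightarrow> y \<in> mspace ?l \<Longrightarrow> dist (f c x) (f c y) \<le> r * mdist ?l x y"
    if "c \<in> K" for c
    using bspec[OF fK that] by blast+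
  have lip: "Lipschitz_continuous_map ?l euclidean_metric (f c)" if "c \<in> K" for c
    using f(2)[OF that] unfolding Lipschitz_continuous_map_def by auto
  have Lip: "Lip ?l euclidean_metric (f c) \<le> r" if "c \<in> K" for c
    using Lip_least(3)[OF lip[OF that], of r] f(2)[OF that] r by simp
  have "GIFS_infty euclidean_metric (f ` T)"
    unfolding GIFS_infty_def contraction_map_def
  proof (intro conjI ballI)
    fix f' assume "f' \<in> f ` T"
    then obtain c where c: "c \<in> K" "f' = f c" using T(2) by blast
    show "Lipschitz_continuous_map ?l euclidean_metric f'" "C1 euclidean_metric f'"
      using lip[OF c(1)] C1_euclidean c(2) by auto
    show "Lip ?l euclidean_metric f' < 1" using Lip[OF c(1)] r c(2) by simp
  qed (use T(1) \<open>T \<noteq> {}\<close> in auto)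
  moreover have "is_fractal euclidean_metric (f ` T) K"
  proof -
    \<comment> \<open>The images are already closed, so the closure in \<open>is_fractal\<close>
      adds no points.\<close>
    have "closure (f c ` ?P) = K \<inter> cball c e" if "c \<in> T" for c
      using f(1)[of c] that T(2) compact_imp_closed[OF K(1)] by (metis closed_Int closed_cball closure_closed subsetD)
    then have "(\<Union>c\<in>T. closure (f c ` ?P)) = (\<Union>c\<in>T. K \<inter> cball c e)" by simp
    also have "\<dots> = K" using T(3) ball_subset_cball by blast
    finally show ?thesis
      using K(1) AB by (simp add: is_fractal_def nonempty_compacts_euclidean)
  qed
  moreover have "\<forall>f'\<in>f ` T. Lip ?l euclidean_metric f' \<le> r" using Lip T(2) by blast
  ultimately show ?thesis by blast
qed

section \<open>Disconnected sets are open and dense in the hyperspace\<close>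

text \<open>The \<open>d/2\<close>-neighbourhoods of \<open>A\<close> and \<open>B\<close> are
  disjoint by the gap. A set closer to \<open>K\<close> than \<open>d/2\<close> lies in their union
  and meets both.\<close>

lemma disconnected_hausdorff_nearby:
  fixes K :: "'a::heine_borel set"
  assumes "compact K" "\<not> connected K"
  shows "\<exists>e>0. \<forall>K'\<in>nonempty_compacts euclidean_metric.
    hausdorff_dist euclidean_metric K K' < e \<longrightarrow> \<not> connected K'"
proof -
  obtain A B d where AB: "K = A \<union> B" "A \<noteq> {}" "B \<noteq> {}" and d: "0 < d"
    "\<And>x y. x \<in> A \<Longrightarrow> y \<in> B \<Longrightarrow> d \<le> dist x y"
    using compact_disconnectedE[OF assms] by metis
  let ?U = "\<Union>a\<in>A. ball a (d/2)" and ?V = "\<Union>b\<in>B. ball b (d/2)"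
  have K: "K \<in> nonempty_compacts euclidean_metric"
    using assms AB by (simp add: nonempty_compacts_euclidean)
  have "\<not> connected K'" if K': "K' \<in> nonempty_compacts euclidean_metric"
    and h: "hausdorff_dist euclidean_metric K K' < d/2" for K'
  proof
    assume "connected K'"
    moreover have "?U \<inter> ?V = {}"
    proof (rule ccontr)
      assume "?U \<inter> ?V \<noteq> {}"
      then obtain a b z where "a \<in> A" "b \<in> B" "dist a z < d/2" "dist b z < d/2" by auto
      then show False using d(2)[of a b] dist_triangle[of a b z] by (simp add: dist_commute)
    qed
    then have "?U \<inter> ?V \<inter> K' = {}" by blast
    moreover have "K' \<subseteq> ?U \<union> ?V"
    proof
      fix y assume "y \<in> K'"
      from hausdorff_dist_approx[OF K' K this, of "d/2"] h
      obtain x where "x \<in> K" "dist y x < d/2" by (auto simp: hausdorff_dist_commute)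
      then show "y \<in> ?U \<union> ?V" using AB(1) by (auto simp: dist_commute)
    qed
    ultimately have "?U \<inter> K' = {} \<or> ?V \<inter> K' = {}"
      by (intro connectedD) auto
    \<comment> \<open>The other half of the Hausdorff distance: points of \<open>A\<close> and of
      \<open>B\<close> have neighbours in \<open>K'\<close>.\<close>
    moreover have "\<exists>y\<in>K'. dist x y < d/2" if "x \<in> K" for x
      using hausdorff_dist_approx[OF K K' that h] by simp
    then have "?U \<inter> K' \<noteq> {}" "?V \<inter> K' \<noteq> {}"
      using AB by (simp_all add: disjoint_iff) blast+
    ultimately show False by blast
  qed
  then show ?thesis using d(1) by (intro exI[of _ "d/2"]) auto
qed

text \<open>A compact set is not the whole space, so it has a frontier point \<open>x\<close>, which
  lies in \<open>K\<close> and has points \<open>y\<close> outside \<open>K\<close> arbitrarily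
  near. Adding such a \<open>y\<close> moves \<open>K\<close> little and makes \<open>y\<close>
  isolated.\<close>

lemma disconnected_dense:
  fixes K :: "'a::euclidean_space set"
  assumes "compact K" "K \<noteq> {}" "0 < e"
  shows "\<exists>K'\<in>nonempty_compacts euclidean_metric.
    hausdorff_dist euclidean_metric K K' < e \<and> \<not> connected K'"
proof -
  have "K \<noteq> UNIV" using assms(1) not_compact_UNIV by blast
  then have "frontier K \<noteq> {}" using assms(2) by (simp add: frontier_eq_empty)
  then obtain x where x: "x \<in> frontier K" by blast
  then have xK: "x \<in> K" using assms(1) frontier_subset_closed[OF compact_imp_closed] by blast
  \<comment> \<open>With \<open>e/2\<close> the weak bound on the Hausdorff distance below still
    yields a strict bound by \<open>e\<close>.\<close>
  obtain y where y: "y \<notin> K" "dist x y < e/2"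
    using x assms(3) unfolding frontier_straddle by (meson half_gt_zero)
  let ?K = "insert y K"
  have cp: "K \<in> nonempty_compacts euclidean_metric" "?K \<in> nonempty_compacts euclidean_metric"
    using assms by (simp_all add: nonempty_compacts_euclidean)
  have "hausdorff_dist euclidean_metric K ?K \<le> e/2"
    unfolding hausdorff_dist_le_iff[OF cp]
  proof (intro conjI ballI allI impI)
    fix a and t :: real assume "a \<in> K" "0 < t"
    then show "\<exists>b\<in>?K. mdist euclidean_metric a b < e/2 + t"
      using assms(3) by (intro bexI[of _ a]) auto
  next
    fix b and t :: real assume b: "b \<in> ?K" and t: "0 < t"
    show "\<exists>a\<in>K. mdist euclidean_metric a b < e/2 + t"
    proof (cases "b = y")
      case True
      then show ?thesis using xK y t by (intro bexI[of _ x]) auto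
    next
      case False
      then show ?thesis using b t assms(3) by (intro bexI[of _ b]) auto
    qed
  qed
  moreover have "\<not> connected ?K"
    unfolding connected_closed not_not
    by (rule exI[of _ "{y}"], rule exI[of _ K])
      (use y assms compact_imp_closed in auto)
  ultimately show ?thesis using cp(2) assms(3) by (intro bexI[of _ ?K]) auto
qed

text \<open>The exceptional sets are all connected. Connected sets form a closed family by openness
  of disconnectedness, with empty interior by density, so the exceptional family is nowhere
  dense.\<close>

lemma typical_disconnected:
  fixes P :: "'a::euclidean_space set \<Rightarrow> bool"
  assumes P: "\<And>K. compact K \<Longrightarrow> \<not> connected K \<Longrightarrow> P K"
  shows "typical_in (hyperspace euclidean_metric) P"
proof -
  let ?M = "nonempty_compacts (euclidean_metric :: 'a metric)"
  interpret H: Metric_space ?M "hausdorff_dist euclidean_metric"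
    by (rule Metric_space_hyperspace)
  have top: "mtopology_of (hyperspace (euclidean_metric :: 'a metric)) = H.mtopology"
    by (simp add: mtopology_of_def)
  let ?N = "?M - {K \<in> ?M. P K}"
  have sub: "H.mtopology closure_of ?N \<subseteq> {K. connected K}"
  proof
    fix K assume K: "K \<in> H.mtopology closure_of ?N"
    have "connected K"
    proof (rule ccontr)
      assume nc: "\<not> connected K"
      have "K \<in> ?M" using K by (simp add: H.metric_closure_of)
      then have "compact K" by (simp add: nonempty_compacts_euclidean)
      from disconnected_hausdorff_nearby[OF this nc] obtain e where e: "e > 0"
        "\<And>K'. K' \<in> ?M \<Longrightarrow> hausdorff_dist euclidean_metric K K' < e \<Longrightarrow> \<not> connected K'" by blast
      obtain K' where "K' \<in> ?N" "K' \<in> H.mball K e"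
        using K e(1) unfolding H.metric_closure_of by blast
      then show False using e(2)[of K'] P[of K'] by (auto simp: nonempty_compacts_euclidean)
    qed
    then show "K \<in> {K. connected K}" by simp
  qed
  have "K \<notin> H.mtopology interior_of (H.mtopology closure_of ?N)" for K
  proof
    assume "K \<in> H.mtopology interior_of (H.mtopology closure_of ?N)"
    then obtain e where K: "K \<in> ?M" and e: "e > 0" "H.mball K e \<subseteq> H.mtopology closure_of ?N"
      unfolding H.metric_interior_of by blast
    then have "compact K" "K \<noteq> {}" by (simp_all add: nonempty_compacts_euclidean)
    from disconnected_dense[OF this e(1)] obtain K' where
      K': "K' \<in> ?M" "hausdorff_dist euclidean_metric K K' < e" "\<not> connected K'"
      by blast
    then have "K' \<in> H.mball K e" using K by simp
    then show False using e(2) sub K'(3) by blast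
  qed
  then have "nowhere_dense_in H.mtopology ?N"
    by (auto simp: nowhere_dense_in_def)
  \<comment> \<open>A single nowhere dense set is meager through the constant sequence.\<close>
  then have "meager_in H.mtopology ?N"
    unfolding meager_in_def by (intro exI[of _ "\<lambda>_. ?N"]) auto
  then show ?thesis
    by (auto simp: typical_in_def comeager_in_def top)
qed

theorem corollary5p12:
  shows "typical_in (hyperspace (euclidean_metric :: (real ^ 'n) metric))
    (\<lambda>K. \<forall>r. 0 < r \<and> r < 1 \<longrightarrow>
       (\<exists>F. GIFS_infty euclidean_metric F \<and> is_fractal euclidean_metric F K \<and>
            (\<forall>f\<in>F. Lip (ell_infty euclidean_metric) euclidean_metric f \<le> r)))"
  \<comment> \<open>Disconnectedness does not depend on \<open>r\<close>, so one co-meager family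
    serves all \<open>r\<close> at once.\<close>
  using disconnected_compact_is_fractal by (intro typical_disconnected allI impI) auto

end
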